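(* Let $k \geq 1$ and $N \geq 2$ be integers, let $\Pi_N = \mathrm{Mon}\langle a,b \mid baa(ba)^N = a\rangle$, and let $U_k \equiv ab^{2k}a^{2k}a$ and $V_k \equiv b^{2k-1}a^{2k}baa$. Then $U_k = V_k$ in $\Pi_N$. Furthermore, the shortest chain of elementary transformations of $\Pi_N$ verifying this equality has length $$\sigma_N(k) := \frac{2N}{N^2-1}\left(N^{2k}-1\right)+4k-2,$$ i.e. $\partial_N(U_k,V_k)=\sigma_N(k)$.
   Context: $\mathrm{Mon}\langle A \mid u=v\rangle$ denotes the quotient of the free monoid $A^\ast$ by the least congruence containing $(u,v)$. An elementary transformation of $\Pi_N$ is a single application of the defining relation: it replaces a word $p\,baa(ba)^N s$ by $p\,a\,s$ or vice versa, for some words $p,s\in\{a,b\}^\ast$. For words $u,v$ equal in $\Pi_N$, $\partial_N(u,v)$ is the length of a shortest sequence of elementary transformations transforming $u$ into $v$. The symbol $\equiv$ denotes equality of words. *)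

theory Defs
  imports Complex_Main
begin

definition monoid_congruence :: "('x list \<times> 'x list) set \<Rightarrow> bool" where
  "monoid_congruence R \<longleftrightarrow>
     equiv UNIV R \<and>
     (\<forall>x x' y y'. (x, x') \<in> R \<longrightarrow> (y, y') \<in> R \<longrightarrow> (x @ y, x' @ y') \<in> R)"

definition least_congruence :: "'x list \<Rightarrow> 'x list \<Rightarrow> ('x list \<times> 'x list) set" where
  "least_congruence u v = \<Inter>{R. monoid_congruence R \<and> (u, v) \<in> R}"

text \<open>The element of the monoid \<open>Mon\<langle>A | u = v\<rangle>\<close> represented by the word \<open>w\<close>;
  the alphabet is the type of letters.\<close>
definition Mon_elem :: "'x list \<Rightarrow> 'x list \<Rightarrow> 'x list \<Rightarrow> 'x list set" where
  "Mon_elem u v w = least_congruence u v `` {w}"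

definition elem_transf :: "'x list \<Rightarrow> 'x list \<Rightarrow> ('x list \<times> 'x list) set" where
  "elem_transf u v =
     {(p @ u @ s, p @ v @ s) | p s. True} \<union> {(p @ v @ s, p @ u @ s) | p s. True}"

text \<open>Only meaningful for words joined by some chain of elementary transformations:
  otherwise \<open>LEAST\<close> has an unspecified value.\<close>
definition elem_dist :: "'x list \<Rightarrow> 'x list \<Rightarrow> 'x list \<Rightarrow> 'x list \<Rightarrow> nat" where
  "elem_dist u v x y = (LEAST n. (x, y) \<in> elem_transf u v ^^ n)"

datatype letter = La | Lb

definition Pi_lhs :: "nat \<Rightarrow> letter list" where
  "Pi_lhs N = [Lb, La, La] @ concat (replicate N [Lb, La])"

definition Pi_rhs :: "letter list" where
  "Pi_rhs = [La]"

definition Pi_elem :: "nat \<Rightarrow> letter list \<Rightarrow> letter list set" where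
  "Pi_elem N = Mon_elem (Pi_lhs N) Pi_rhs"

definition Pi_dist :: "nat \<Rightarrow> letter list \<Rightarrow> letter list \<Rightarrow> nat" where
  "Pi_dist N = elem_dist (Pi_lhs N) Pi_rhs"

definition U_word :: "nat \<Rightarrow> letter list" where
  "U_word k = [La] @ replicate (2 * k) Lb @ replicate (2 * k) La @ [La]"

definition V_word :: "nat \<Rightarrow> letter list" where
  "V_word k = replicate (2 * k - 1) Lb @ replicate (2 * k) La @ [Lb, La, La]"

definition sigma :: "nat \<Rightarrow> nat \<Rightarrow> real" where
  "sigma N k =
     2 * real N / ((real N)\<^sup>2 - 1) * (real N ^ (2 * k) - 1) + 4 * real k - 2"

end

(*
  The two sides of the relation a = baa(ba)^N begin with different letters. Hence chains can be
  peeled from the left without loss: d(cX, cY) = d(X, Y), and, since in a shortest chain from aX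
  to bY the first letter changes exactly once, d(aX, bY) = 1 + d(aa(ba)^N X, Y). These equations
  determine every finite distance, so that the distance of U_k and V_k can simply be computed.
*)
theory Submission
  imports Defs
begin

section \<open>Distances for a relation whose sides start with different letters\<close>

lemma elem_transf_append:
  assumes "(x, y) \<in> elem_transf u v"
  shows "(p @ x @ s, p @ y @ s) \<in> elem_transf u v"
proof -
  obtain p' s' where "x = p' @ u @ s' \<and> y = p' @ v @ s' \<or> x = p' @ v @ s' \<and> y = p' @ u @ s'"
    using assms by (auto simp: elem_transf_def)
  then have "p @ x @ s = (p @ p') @ u @ (s' @ s) \<and> p @ y @ s = (p @ p') @ v @ (s' @ s) \<or>
      p @ x @ s = (p @ p') @ v @ (s' @ s) \<and> p @ y @ s = (p @ p') @ u @ (s' @ s)"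
    by auto
  then show ?thesis
    unfolding elem_transf_def by blast
qed

lemma elem_transf_relpow_append:
  "(x, y) \<in> elem_transf u v ^^ n \<Longrightarrow> (p @ x, p @ y) \<in> elem_transf u v ^^ n"
proof (induction n arbitrary: y)
  case (Suc n)
  then obtain z where "(x, z) \<in> elem_transf u v ^^ n" "(z, y) \<in> elem_transf u v"
    by auto
  then have "(p @ x, p @ z) \<in> elem_transf u v ^^ n" "(p @ z, p @ y) \<in> elem_transf u v"
    using Suc.IH elem_transf_append[of z y u v p "[]"] by auto
  then show ?case
    by auto
qed simp

lemmas elem_transf_relpow_Cons = elem_transf_relpow_append[of _ _ _ _ _ "[c]" for c, simplified]

lemma elem_transf_cases:
  assumes "(s, t) \<in> elem_transf (b # w) [a]"
  obtains (tail) c x y where "s = c # x" "t = c # y" "(x, y) \<in> elem_transf (b # w) [a]"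
  | (expand) z where "s = a # z" "t = b # w @ z"
  | (contract) z where "s = b # w @ z" "t = a # z"
proof -
  obtain p q where pq: "s = p @ (b # w) @ q \<and> t = p @ [a] @ q \<or> s = p @ [a] @ q \<and> t = p @ (b # w) @ q"
    using assms by (auto simp: elem_transf_def)
  show thesis
  proof (cases p)
    case Nil
    then show thesis
      using pq that(2,3) by auto
  next
    case (Cons c p')
    then have "s = c # p' @ (b # w) @ q \<and> t = c # p' @ [a] @ q \<or>
        s = c # p' @ [a] @ q \<and> t = c # p' @ (b # w) @ q"
      using pq by simp
    moreover have "(p' @ (b # w) @ q, p' @ [a] @ q) \<in> elem_transf (b # w) [a]"
      "(p' @ [a] @ q, p' @ (b # w) @ q) \<in> elem_transf (b # w) [a]"
      unfolding elem_transf_def by blast+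
    ultimately show thesis
      using that(1) by blast
  qed
qed

context
  fixes a b :: 'x and w :: "'x list"
  assumes ab: "a \<noteq> b"
begin

text \<open>Simultaneous strong induction on the length of the chain, split by its first step. The
  strict bounds in the mixed cases record that at least one step of the chain exchanges the leading
  \<open>a\<close> and \<open>b\<close>.\<close>

lemma peel_chain:
  fixes m :: nat
  assumes "(s, t) \<in> elem_transf (b # w) [a] ^^ m"
  shows "(\<forall>c x y. s = c # x \<longrightarrow> t = c # y \<longrightarrow>
            (\<exists>n\<le>m. (x, y) \<in> elem_transf (b # w) [a] ^^ n)) \<and>
         (\<forall>x y. s = a # x \<longrightarrow> t = b # y \<longrightarrow>
            (\<exists>n<m. (w @ x, y) \<in> elem_transf (b # w) [a] ^^ n)) \<and>
         (\<forall>x y. s = b # x \<longrightarrow> t = a # y \<longrightarrow>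
            (\<exists>n<m. (x, w @ y) \<in> elem_transf (b # w) [a] ^^ n))"
  using assms
proof (induction m arbitrary: s t rule: less_induct)
  case (less m)
  let ?E = "elem_transf (b # w) [a]"
  \<comment> \<open>A whole prefix is peeled letter by letter; no letter lengthens the chain, so the
    outer induction hypothesis stays applicable.\<close>
  have cancel: "\<exists>j\<le>n. (x, y) \<in> ?E ^^ j" if "n < m" "(p @ x, p @ y) \<in> ?E ^^ n" for n p x y
    using that
  proof (induction p arbitrary: n)
    case (Cons c p)
    from less.IH[OF Cons.prems] obtain i where i: "i \<le> n" "(p @ x, p @ y) \<in> ?E ^^ i"
      by auto
    then have "i < m"
      using Cons.prems(1) by simp
    from Cons.IH[OF this i(2)] show ?case
      using i(1) le_trans by blast
  qed auto
  show ?case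
  proof (cases m)
    case 0
    then show ?thesis
      using less.prems ab by auto
  next
    case (Suc l)
    then obtain s' where s': "(s, s') \<in> ?E" "(s', t) \<in> ?E ^^ l"
      using relpow_Suc_D2[OF less.prems[unfolded Suc]] by blast
    note IH = less.IH[OF _ s'(2), unfolded Suc, OF lessI]
    note same = IH[THEN conjunct1, rule_format]
      and a_b = IH[THEN conjunct2, THEN conjunct1, rule_format]
      and b_a = IH[THEN conjunct2, THEN conjunct2, rule_format]
    from s'(1) show ?thesis
    proof (cases rule: elem_transf_cases)
      case (tail c x x')
      \<comment> \<open>The step inside the tail is replayed on the peeled word: behind
        \<open>w\<close> if a leading \<open>a\<close> is later replaced, with empty
        \<open>p\<close> otherwise.\<close>
      have step: "\<exists>n'. n' = Suc n \<and> (p @ x, q) \<in> ?E ^^ n'" if "(p @ x', q) \<in> ?E ^^ n" for n p q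
        using relpow_Suc_I2[OF elem_transf_append[OF tail(3), of p "[]", simplified] that] by blast
      have "\<exists>n\<le>m. (x, y) \<in> ?E ^^ n" if "t = c # y" for y
        using same[OF tail(2) that] step[of "[]"] Suc by fastforce
      moreover have "\<exists>n<m. (w @ x, y) \<in> ?E ^^ n" if "c = a" "t = b # y" for y
        using a_b[OF tail(2)[unfolded that(1)] that(2)] step[of w] Suc by fastforce
      moreover have "\<exists>n<m. (x, w @ y) \<in> ?E ^^ n" if "c = b" "t = a # y" for y
        using b_a[OF tail(2)[unfolded that(1)] that(2)] step[of "[]"] Suc by fastforce
      ultimately show ?thesis
        using tail(1) by blast
    next
      case (expand z)
      \<comment> \<open>The first letter goes from \<open>a\<close> to \<open>b\<close> and back,
        which leaves \<open>w\<close> in front of both tails; the chain between them is shorter than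
        \<open>m\<close>, so \<open>w\<close> cancels.\<close>
      have "\<exists>n\<le>m. (z, y) \<in> ?E ^^ n" if t: "t = a # y" for y
      proof -
        obtain n where n: "n < l" "(w @ z, w @ y) \<in> ?E ^^ n"
          using b_a[OF expand(2) t] by blast
        then have "n < m"
          using Suc by simp
        from cancel[OF this n(2)] obtain j where "j \<le> n" "(z, y) \<in> ?E ^^ j"
          by blast
        then show ?thesis
          using \<open>n < m\<close> le_trans less_imp_le by blast
      qed
      moreover have "\<exists>n<m. (w @ z, y) \<in> ?E ^^ n" if "t = b # y" for y
        using same[OF expand(2) that] Suc less_Suc_eq_le by blast
      ultimately show ?thesis
        using expand(1) ab by blast
    next
      case (contract z)
      have "\<exists>n\<le>m. (w @ z, y) \<in> ?E ^^ n" if "t = b # y" for y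
        using a_b[OF contract(2) that] Suc by (meson less_SucI less_imp_le)
      moreover have "\<exists>n<m. (w @ z, w @ y) \<in> ?E ^^ n" if "t = a # y" for y
        using same[OF contract(2) that] Suc less_Suc_eq_le
        by (metis elem_transf_relpow_append)
      ultimately show ?thesis
        using contract(1) ab by blast
    qed
  qed
qed

end

section \<open>Runs of the algorithm realise the distance\<close>

text \<open>The runs of Adian's left-divisibility algorithm, with the number of replacements made.\<close>
inductive adian :: "'x \<Rightarrow> 'x \<Rightarrow> 'x list \<Rightarrow> 'x list \<Rightarrow> 'x list \<Rightarrow> nat \<Rightarrow> bool" for a b w where
  Nil: "adian a b w [] [] 0"
| Cons: "adian a b w x y n \<Longrightarrow> adian a b w (c # x) (c # y) n"
| left: "adian a b w (w @ x) y n \<Longrightarrow> adian a b w (a # x) (b # y) (Suc n)"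
| right: "adian a b w x (w @ y) n \<Longrightarrow> adian a b w (b # x) (a # y) (Suc n)"

lemma adian_chain: "adian a b w x y n \<Longrightarrow> (x, y) \<in> elem_transf (b # w) [a] ^^ n"
proof (induction rule: adian.induct)
  case (Cons x y n c)
  then show ?case
    by (simp add: elem_transf_relpow_Cons)
next
  case (left x y n)
  have "([] @ [a] @ x, [] @ (b # w) @ x) \<in> elem_transf (b # w) [a]"
    unfolding elem_transf_def by blast
  then show ?case
    using elem_transf_relpow_Cons[OF left.IH] relpow_Suc_I2 by fastforce
next
  case (right x y n)
  have "([] @ (b # w) @ y, [] @ [a] @ y) \<in> elem_transf (b # w) [a]"
    unfolding elem_transf_def by blast
  then show ?case
    using elem_transf_relpow_Cons[OF right.IH] relpow_Suc_I by fastforce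
qed simp

text \<open>Peeling any competing chain follows the rules of the run; the strict inequality in
  \<open>peel_chain\<close> pays for each \<open>Suc\<close>.\<close>

lemma adian_le_chain:
  "adian a b w x y n \<Longrightarrow> a \<noteq> b \<Longrightarrow> (x, y) \<in> elem_transf (b # w) [a] ^^ m \<Longrightarrow> n \<le> m"
proof (induction arbitrary: m rule: adian.induct)
  case (Cons x y n c)
  then show ?case
    using peel_chain[OF Cons.prems] le_trans by blast
next
  case (left x y n)
  then obtain j where "j < m" "(w @ x, y) \<in> elem_transf (b # w) [a] ^^ j"
    using peel_chain[OF left.prems] by blast
  then show ?case
    using left.IH[OF left.prems(1)] by fastforce
next
  case (right x y n)
  then obtain j where "j < m" "(x, w @ y) \<in> elem_transf (b # w) [a] ^^ j"
    using peel_chain[OF right.prems] by blast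
  then show ?case
    using right.IH[OF right.prems(1)] by fastforce
qed simp

lemma adian_elem_dist:
  assumes "adian a b w x y n" "a \<noteq> b"
  shows "elem_dist (b # w) [a] x y = n"
  unfolding elem_dist_def
  using assms by (intro Least_equality) (auto intro: adian_chain adian_le_chain)

lemma adian_sym: "adian a b w x y n \<Longrightarrow> adian a b w y x n"
  by (induction rule: adian.induct) (auto intro: adian.intros)

lemma adian_append: "adian a b w x y n \<Longrightarrow> adian a b w (p @ x) (p @ y) n"
  by (induction p) (auto intro: adian.intros)

lemma adian_refl: "adian a b w x x 0"
  by (induction x) (auto intro: adian.intros)

section \<open>From chains to equality in the presented monoid\<close>

lemma monoid_congruence_Inter:
  assumes "\<And>R. R \<in> \<R> \<Longrightarrow> monoid_congruence R"
  shows "monoid_congruence (\<Inter>\<R>)"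
proof -
  have "refl R" "sym R" "trans R" if "R \<in> \<R>" for R
    using assms[OF that] by (simp_all add: monoid_congruence_def equiv_def)
  then have "refl (\<Inter>\<R>)" "sym (\<Inter>\<R>)" "trans (\<Inter>\<R>)"
    using refl_on_INTER[of \<R> "\<lambda>_. UNIV" id] sym_INTER[of \<R> id] trans_INTER[of \<R> id]
    by auto
  moreover have "\<And>x x' y y'. (x, x') \<in> \<Inter>\<R> \<Longrightarrow> (y, y') \<in> \<Inter>\<R> \<Longrightarrow> (x @ y, x' @ y') \<in> \<Inter>\<R>"
    using assms by (auto simp: monoid_congruence_def)
  ultimately show ?thesis
    by (auto simp: monoid_congruence_def equiv_def)
qed

lemma monoid_congruence_least: "monoid_congruence (least_congruence u v)"
  unfolding least_congruence_def by (rule monoid_congruence_Inter) simp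

lemma Mon_elem_eq_of_chain:
  assumes "(x, y) \<in> elem_transf u v ^^ n"
  shows "Mon_elem u v x = Mon_elem u v y"
proof -
  let ?R = "least_congruence u v"
  have eq: "equiv UNIV ?R"
    and app: "\<And>x x' y y'. (x, x') \<in> ?R \<Longrightarrow> (y, y') \<in> ?R \<Longrightarrow> (x @ y, x' @ y') \<in> ?R"
    using monoid_congruence_least[of u v] unfolding monoid_congruence_def by blast+
  have refl: "(z, z) \<in> ?R" for z
    using eq by (simp add: equiv_def refl_on_def)
  have "(u, v) \<in> ?R"
    by (simp add: least_congruence_def)
  then have uv: "(p @ u @ s, p @ v @ s) \<in> ?R" for p s
    by (intro app refl)
  have step: "(s, t) \<in> ?R" if "(s, t) \<in> elem_transf u v" for s t
    using that uv eq unfolding elem_transf_def equiv_def sym_def by auto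
  have "(x, y) \<in> ?R"
    using assms
  proof (induction n arbitrary: y)
    case (Suc n)
    then show ?case
      using eq step unfolding equiv_def by (auto elim!: relpow_Suc_E dest: transD)
  qed (auto simp: refl)
  then show ?thesis
    unfolding Mon_elem_def using eq by (simp add: equiv_class_eq)
qed

section \<open>The run of the algorithm on \<open>U\<^sub>k\<close> and \<open>V\<^sub>k\<close>\<close>

abbreviation ba_pow :: "nat \<Rightarrow> letter list" where
  "ba_pow n \<equiv> concat (replicate n [Lb, La])"

abbreviation Pi_adian :: "nat \<Rightarrow> letter list \<Rightarrow> letter list \<Rightarrow> nat \<Rightarrow> bool" where
  "Pi_adian N \<equiv> adian La Lb (La # La # ba_pow N)"

text \<open>With f for this map, one replacement turns the pair \<open>a x\<close>,
  \<open>b y\<close> into \<open>a f(x)\<close>, \<open>y\<close>.\<close>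

abbreviation prepend_a_ba_pow :: "nat \<Rightarrow> letter list \<Rightarrow> letter list" where
  "prepend_a_ba_pow N x \<equiv> La # ba_pow N @ x"

lemma ba_pow_add: "ba_pow (m + n) = ba_pow m @ ba_pow n"
  by (simp add: replicate_add)

text \<open>Each leading \<open>ba\<close> costs one replacement and, after cancelling an
  \<open>a\<close>, inserts \<open>(ba)^N\<close> behind the \<open>a\<close> of the other
  word.\<close>

lemma Pi_adian_ba_pow:
  "Pi_adian N x (La # ba_pow (N * j) @ y) n \<Longrightarrow> Pi_adian N (ba_pow j @ x) (La # y) (n + j)"
proof (induction j arbitrary: y)
  case (Suc j)
  have "Pi_adian N (ba_pow j @ x) (La # ba_pow N @ y) (n + j)"
    using Suc.IH[of "ba_pow N @ y"] Suc.prems by (simp add: ba_pow_add add.commute)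
      (metis append_assoc ba_pow_add add.commute)
  then show ?case
    by (auto intro!: adian.intros)
qed simp

lemma Pi_adian_b_pow:
  "Pi_adian N (La # (prepend_a_ba_pow N ^^ m) x) y n
     \<Longrightarrow> Pi_adian N (La # x) (replicate m Lb @ y) (n + m)"
proof (induction m arbitrary: x)
  case (Suc m)
  have "Pi_adian N (La # prepend_a_ba_pow N x) (replicate m Lb @ y) (n + m)"
    using Suc.IH[of "prepend_a_ba_pow N x"] Suc.prems unfolding funpow_Suc_right o_apply by blast
  then show ?case
    by (auto intro!: adian.intros)
qed simp

text \<open>The first \<open>a\<close> on the right absorbs \<open>(ba)^(r+1)\<close> and becomes
  \<open>a(ba)^(N(r+1))\<close>. Cancelling \<open>a(ba)^N\<close> leaves \<open>(ba)^(Nr)\<close>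
  on the right, which the remaining \<open>a\<close> on the left absorbs in turn. The exponent thus
  passes from r+1 to N^2 r + N.\<close>

lemma Pi_adian_aa:
  assumes "Pi_adian N (ba_pow (N * (N * r) + N) @ x) y n"
  shows "Pi_adian N (ba_pow (Suc r) @ prepend_a_ba_pow N (prepend_a_ba_pow N x)) (La # La # y)
    (n + Suc r + N * r)"
proof -
  \<comment> \<open>The run is assembled from its end, since the rules of \<open>adian\<close> add
    replacements at the front.\<close>
  have "Pi_adian N (La # ba_pow (N * (N * r)) @ ba_pow N @ x) (La # y) n"
    using assms by (auto simp: ba_pow_add intro!: adian.Cons)
  then have "Pi_adian N (La # y) (La # ba_pow (N * (N * r)) @ ba_pow N @ x) n"
    by (rule adian_sym)
  then have "Pi_adian N (prepend_a_ba_pow N x) (ba_pow (N * r) @ La # y) (n + N * r)"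
    by (rule adian_sym[OF Pi_adian_ba_pow])
  then have "Pi_adian N (prepend_a_ba_pow N (prepend_a_ba_pow N x))
      (La # ba_pow N @ ba_pow (N * r) @ La # y) (n + N * r)"
    by (intro adian.Cons adian_append)
  then have "Pi_adian N (prepend_a_ba_pow N (prepend_a_ba_pow N x))
      (La # ba_pow (N * Suc r) @ La # y) (n + N * r)"
    by (simp add: ba_pow_add)
  from Pi_adian_ba_pow[OF this] show ?thesis
    by (simp add: algebra_simps)
qed

text \<open>One less than the exponent of \<open>ba\<close> reached after peeling \<open>2 * i\<close> letters \<open>a\<close>, so that
  no subtraction occurs.\<close>
fun ba_exponent :: "nat \<Rightarrow> nat \<Rightarrow> nat" where
  "ba_exponent N 0 = N - 1"
| "ba_exponent N (Suc i) = N * (N * ba_exponent N i) + (N - 1)"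

text \<open>The increment is the cost of one pair \<open>aa\<close> in \<open>Pi_adian_aa\<close> at
  r = \<open>ba_exponent N i\<close>.\<close>

fun peel_cost :: "nat \<Rightarrow> nat \<Rightarrow> nat" where
  "peel_cost N 0 = 0"
| "peel_cost N (Suc i) = peel_cost N i + Suc (ba_exponent N i) + N * ba_exponent N i"

lemma Pi_adian_a_pow:
  assumes "N \<ge> 1"
  shows "Pi_adian N (ba_pow (Suc (ba_exponent N i)) @ x) y n
     \<Longrightarrow> Pi_adian N (ba_pow N @ (prepend_a_ba_pow N ^^ (2 * i)) x) (replicate (2 * i) La @ y)
           (n + peel_cost N i)"
proof (induction i arbitrary: x y n)
  case 0
  then show ?case
    using assms by simp
next
  case (Suc i)
  have "Suc (ba_exponent N (Suc i)) = N * (N * ba_exponent N i) + N"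
    using assms by simp
  then have "Pi_adian N (ba_pow (Suc (ba_exponent N i)) @ (prepend_a_ba_pow N (prepend_a_ba_pow N x)))
      (La # La # y) (n + Suc (ba_exponent N i) + N * ba_exponent N i)"
    using Suc.prems by (intro Pi_adian_aa) metis
  from Suc.IH[OF this] show ?case
    by (simp add: funpow_Suc_right replicate_app_Cons_same algebra_simps del: funpow.simps)
qed

lemma funpow_Suc_both: "(f ^^ (2 * Suc i)) x = f ((f ^^ (2 * i)) (f x))"
  by (simp add: funpow_swap1)

text \<open>Two passes of the same kind: the letters \<open>b\<close> of one word pile up maps f on
  the other, and the letters \<open>a\<close> then consume them. The first pass ends with
  \<open>P\<close> against \<open>a(ba)^(Nr)\<close>; the second runs with the sides exchanged. The
  proof derives the second pass first.\<close>

lemma Pi_adian_U_V: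
  assumes "N \<ge> 1"
  shows "Pi_adian N (U_word (Suc i)) (V_word (Suc i))
    (2 * (peel_cost N i + Suc (ba_exponent N i)) + 4 * i + 2)"
proof -
  define r where "r = ba_exponent N i"
  define c where "c = peel_cost N i"
  let ?f = "prepend_a_ba_pow N"
  define P where "P = replicate (2 * Suc i) Lb @ replicate (2 * i) La @ [La, La, La]"
  \<comment> \<open>The run stops here: the words agree because N + Nr = N(r+1).\<close>
  have "Pi_adian N (?f (ba_pow (N * r))) (La # ba_pow (N * Suc r) @ []) 0"
    using adian_refl by (simp add: ba_pow_add)
  from Pi_adian_ba_pow[OF this]
  have "Pi_adian N (ba_pow (Suc r) @ ?f (ba_pow (N * r))) [La] (Suc r)"
    by simp
  from Pi_adian_a_pow[OF assms this[unfolded r_def]]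
  have "Pi_adian N (ba_pow N @ (?f ^^ (2 * i)) (?f (ba_pow (N * r)))) (replicate (2 * i) La @ [La])
      (Suc r + c)"
    unfolding r_def c_def .
  then have "Pi_adian N (La # ?f ((?f ^^ (2 * i)) (?f (ba_pow (N * r)))))
      (La # La # replicate (2 * i) La @ [La]) (Suc r + c)"
    by (intro adian.Cons)
  then have "Pi_adian N (La # (?f ^^ (2 * Suc i)) (ba_pow (N * r)))
      (replicate (2 * i) La @ [La, La, La]) (Suc r + c)"
    unfolding funpow_Suc_both by (simp add: replicate_app_Cons_same)
  from Pi_adian_b_pow[OF this]
  have "Pi_adian N P (La # ba_pow (N * r)) (Suc r + c + 2 * Suc i)"
    unfolding P_def by (rule adian_sym)
  then have "Pi_adian N (ba_pow r @ P) [La] (Suc r + c + 2 * Suc i + r)"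
    by (intro Pi_adian_ba_pow) simp
  then have "Pi_adian N (ba_pow (Suc r) @ P) [Lb, La, La] (Suc r + c + 2 * Suc i + r)"
    by (auto intro: adian.Cons)
  from Pi_adian_a_pow[OF assms this[unfolded r_def]]
  have "Pi_adian N (ba_pow N @ (?f ^^ (2 * i)) P) (replicate (2 * i) La @ [Lb, La, La])
      (Suc r + c + 2 * Suc i + r + c)"
    unfolding r_def c_def .
  \<comment> \<open>The exponent 2i+1 is 2k-1, the number of leading letters \<open>b\<close> of
    \<open>V_word k\<close> for k = i+1.\<close>
  then have "Pi_adian N (La # (?f ^^ (Suc (2 * i))) P) (La # La # replicate (2 * i) La @ [Lb, La, La])
      (Suc r + c + 2 * Suc i + r + c)"
    by (auto intro!: adian.Cons)
  from Pi_adian_b_pow[OF this] show ?thesis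
    unfolding P_def U_word_def V_word_def r_def c_def
    by (simp add: replicate_app_Cons_same algebra_simps)
qed

section \<open>Closed forms of exponent and cost\<close>

text \<open>For e = \<open>ba_exponent N i\<close> + 1 the recurrence is e' = N^2 e - N(N-1), with
  fixed point N/(N+1); hence the factor N+1.\<close>

lemma ba_exponent_closed:
  assumes "N \<ge> 1"
  shows "(real N + 1) * (real (ba_exponent N i) + 1) = real N ^ (2 * i + 2) + real N"
proof (induction i)
  case 0
  then show ?case
    using assms by (simp add: of_nat_diff power2_eq_square algebra_simps)
next
  case (Suc i)
  have "(real N + 1) * (real (ba_exponent N (Suc i)) + 1)
      = (real N)\<^sup>2 * ((real N + 1) * (real (ba_exponent N i) + 1)) - (real N)\<^sup>2 * (real N + 1)
        + real N * (real N + 1)"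
    using assms by (simp add: of_nat_diff power2_eq_square algebra_simps)
  then show ?case
    unfolding Suc by (simp add: power2_eq_square algebra_simps)
qed

text \<open>The bracketed sum grows by N^(2i+3) from i to i+1, so it is the geometric sum N + N^3 +
  ... + N^(2i+1).\<close>

lemma peel_cost_closed:
  assumes "N \<ge> 1"
  shows "((real N)\<^sup>2 - 1) * (real (peel_cost N i) + real (ba_exponent N i) + 1)
    = real N * (real N ^ (2 * i + 2) - 1)"
proof (induction i)
  case 0
  then show ?case
    using assms by (simp add: of_nat_diff power2_eq_square algebra_simps)
next
  case (Suc i)
  have "real (peel_cost N (Suc i)) + real (ba_exponent N (Suc i)) + 1
      = (real (peel_cost N i) + real (ba_exponent N i) + 1)
        + real N * ((real N + 1) * (real (ba_exponent N i) + 1)) - (real N)\<^sup>2"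
    using assms by (simp add: of_nat_diff power2_eq_square algebra_simps)
  also have "\<dots> = (real (peel_cost N i) + real (ba_exponent N i) + 1) + real N ^ (2 * i + 3)"
    unfolding ba_exponent_closed[OF assms]
    by (simp add: power2_eq_square power3_eq_cube power_add algebra_simps)
  finally have "((real N)\<^sup>2 - 1) * (real (peel_cost N (Suc i)) + real (ba_exponent N (Suc i)) + 1)
      = real N * (real N ^ (2 * i + 2) - 1) + ((real N)\<^sup>2 - 1) * real N ^ (2 * i + 3)"
    unfolding Suc[symmetric] by (simp only: distrib_left)
  then show ?case
    by (simp add: power2_eq_square power3_eq_cube power_add algebra_simps)
qed

theorem mainTheorem2:
  fixes k N :: nat
  assumes "k \<ge> 1" and "N \<ge> 2"
  shows "Pi_elem N (U_word k) = Pi_elem N (V_word k) \<and>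
         real (Pi_dist N (U_word k) (V_word k)) = sigma N k"
proof -
  obtain i where k: "k = Suc i"
    using assms(1) by (cases k) auto
  let ?n = "2 * (peel_cost N i + Suc (ba_exponent N i)) + 4 * i + 2"
  have N: "N \<ge> 1"
    using assms(2) by simp
  have lhs: "Pi_lhs N = Lb # La # La # ba_pow N"
    by (simp add: Pi_lhs_def)
  have run: "Pi_adian N (U_word k) (V_word k) ?n"
    unfolding k by (rule Pi_adian_U_V[OF N])
  have "Pi_elem N (U_word k) = Pi_elem N (V_word k)"
    unfolding Pi_elem_def lhs Pi_rhs_def by (rule Mon_elem_eq_of_chain[OF adian_chain[OF run]])
  moreover have "Pi_dist N (U_word k) (V_word k) = ?n"
    unfolding Pi_dist_def lhs Pi_rhs_def by (rule adian_elem_dist[OF run]) simp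
  \<comment> \<open>Excluding N = 1 keeps the denominator in \<open>sigma\<close> nonzero.\<close>
  moreover have "(real N)\<^sup>2 - 1 \<noteq> 0"
    using assms(2) by (simp add: power2_eq_1_iff)
  then have "real (peel_cost N i) + real (ba_exponent N i) + 1
      = real N * (real N ^ (2 * k) - 1) / ((real N)\<^sup>2 - 1)"
    using peel_cost_closed[OF N, of i] k by (simp add: field_simps)
  then have "sigma N k = 2 * (real (peel_cost N i) + real (ba_exponent N i) + 1) + 4 * real k - 2"
    by (simp add: sigma_def)
  then have "real ?n = sigma N k"
    by (simp add: k)
  ultimately show ?thesis
    by simp
qed

end
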